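(* Let $n\ge1$ be an integer, let $\lambda\in(0,1)$, let $p\geq 1$ be a real number with Hölder conjugate $q$, and let $K,L\subset\mathbb{R}^n$ be non-empty bounded sets. Let $-1/n\leq\alpha\leq\infty$ and let $f,g,h:\mathbb{R}^n\longrightarrow\mathbb{R}_{\geq 0}$ be non-negative functions such that $$h\Bigl((1-\lambda)^{1/p}(1-\mu)^{1/q}x+\lambda^{1/p}\mu^{1/q}y\Bigr)\geq\Bigl[(1-\lambda)^{1/p}(1-\mu)^{1/q}f(x)^{\alpha}+\lambda^{1/p}\mu^{1/q}g(y)^{\alpha}\Bigr]^{1/\alpha}$$ for all $x\in K$, $y\in L$ with $f(x)g(y)>0$ and all $\mu\in[0,1]$. Then $$\sum_{z\in(M_p+(-1,1)^n)\cap\mathbb{Z}^n} h^{\diamond}(z)\ \geq\ \mathcal{M}_{\frac{p\alpha}{n\alpha+1}}^{\lambda}\left(\sum_{x\in K\cap\mathbb{Z}^n}f(x),\ \sum_{y\in L\cap\mathbb{Z}^n}g(y)\right),$$ where $M_p=(1-\lambda)\cdot K+_p\lambda\cdot L$.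
   Context: Sets and $p$-sums. $+$ between sets is Minkowski addition, $A+B=\{a+b:a\in A,\ b\in B\}$, and $rA=\{ra:a\in A\}$ for $r\ge0$. For real $p\ge1$ the Hölder conjugate $q\in(1,\infty]$ satisfies $1/p+1/q=1$. For arbitrary $A,B\subset\mathbb{R}^n$, $$A+_pB=\bigl\{(1-\mu)^{1/q}x+\mu^{1/q}y:\ x\in A,\ y\in B,\ 0\le\mu\le1\bigr\}.$$ When $p=1$ (so $q=\infty$), the coefficients $(1-\mu)^{1/q}$ and $\mu^{1/q}$ are always understood to be $1$ for all $\mu\in[0,1]$ (here and in the hypothesis on $f,g,h$). Moreover $r\cdot A=r^{1/p}A$ for $r\ge0$, and $r\cdot A+_ps\cdot B$ means $(r\cdot A)+_p(s\cdot B)$. Means. For $a,b>0$ and $\lambda\in(0,1)$: $\mathcal{M}_\beta^\lambda(a,b)=((1-\lambda)a^\beta+\lambda b^\beta)^{1/\beta}$ for $\beta\in\mathbb{R}\setminus\{0\}$; $\mathcal{M}_0^\lambda(a,b)=a^{1-\lambda}b^\lambda$; $\mathcal{M}_\infty^\lambda(a,b)=\max\{a,b\}$; $\mathcal{M}_{-\infty}^\lambda(a,b)=\min\{a,b\}$. If $ab=0$ then $\mathcal{M}_\beta^\lambda(a,b)=0$ for all $\beta\in\mathbb{R}\cup\{\pm\infty\}$. The index $\frac{p\alpha}{n\alpha+1}$ is understood as $p/n$ when $\alpha=\infty$ and as $-\infty$ when $\alpha=-1/n$. Conventions for the hypothesis. For $\alpha=\infty$ the right-hand side $[t f(x)^\alpha+s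 g(y)^\alpha]^{1/\alpha}$ is understood as $\max\{f(x),g(y)\}$. For $\alpha=0$ the whole hypothesis is understood as: $h((1-\lambda)x+\lambda y)\ge f(x)^{1-\lambda}g(y)^\lambda$ for all $x\in K$, $y\in L$ with $f(x)g(y)>0$. For $\phi:\mathbb{R}^n\to\mathbb{R}_{\ge0}$, $\phi^{\diamond}(z)=\sup_{u\in(-1,1)^n}\phi(z+u)$ for $z\in\mathbb{R}^n$ (the supremum taken in $[0,+\infty]$). *)

theory Defs
  imports "HOL-Analysis.Analysis"
begin

definition holder_conjugate :: "real \<Rightarrow> ereal \<Rightarrow> bool" where
  "holder_conjugate p q \<longleftrightarrow> 1 < q \<and> 1 / ereal p + 1 / q = 1"

text \<open>The coefficient \<open>t\<close> to the power \<open>1/q\<close>. It is \<open>1\<close> for \<open>q = \<infinity>\<close>, also at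
  \<open>t = 0\<close>, whereas \<open>0 powr 0 = 0\<close>.\<close>

definition hcoeff :: "ereal \<Rightarrow> real \<Rightarrow> real" where
  "hcoeff q t = (if q = \<infinity> then 1 else t powr (1 / real_of_ereal q))"

text \<open>The sum \<open>A +\<^sub>p B\<close>. It depends on \<open>p\<close> only through its conjugate \<open>q\<close>, which is the
  parameter here.\<close>

definition psum :: "ereal \<Rightarrow> 'a::real_vector set \<Rightarrow> 'a set \<Rightarrow> 'a set" where
  "psum q A B = {hcoeff q (1 - \<mu>) *\<^sub>R x + hcoeff q \<mu> *\<^sub>R y | x y \<mu>. x \<in> A \<and> y \<in> B \<and> 0 \<le> \<mu> \<and> \<mu> \<le> 1}"

definition pscale :: "real \<Rightarrow> real \<Rightarrow> 'a::real_vector set \<Rightarrow> 'a set" where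
  "pscale p r A = (\<lambda>x. (r powr (1 / p)) *\<^sub>R x) ` A"

definition pmean :: "ereal \<Rightarrow> real \<Rightarrow> real \<Rightarrow> real \<Rightarrow> real" where
  "pmean \<beta> lam a b =
     (if a * b = 0 then 0
      else if \<beta> = \<infinity> then max a b
      else if \<beta> = -\<infinity> then min a b
      else if \<beta> = 0 then a powr (1 - lam) * b powr lam
      else ((1 - lam) * a powr real_of_ereal \<beta> + lam * b powr real_of_ereal \<beta>)
             powr (1 / real_of_ereal \<beta>))"

text \<open>The index \<open>p\<alpha> / (n\<alpha> + 1)\<close> with its limiting values at \<open>\<alpha> = \<infinity>\<close> and \<open>\<alpha> = -1/n\<close>.\<close>

definition mean_index :: "nat \<Rightarrow> real \<Rightarrow> ereal \<Rightarrow> ereal" where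
  "mean_index n p \<alpha> =
     (if \<alpha> = \<infinity> then ereal (p / real n)
      else if \<alpha> = ereal (- 1 / real n) then -\<infinity>
      else ereal (p * real_of_ereal \<alpha> / (real n * real_of_ereal \<alpha> + 1)))"

text \<open>The expression \<open>[s a\<^sup>\<alpha> + t b\<^sup>\<alpha>]\<close> to the power \<open>1/\<alpha>\<close>, for \<open>a, b > 0\<close> and
  \<open>\<alpha> \<noteq> 0, -\<infinity>\<close>. The weights \<open>s, t\<close> need not add up to \<open>1\<close>.\<close>

definition wcomb :: "ereal \<Rightarrow> real \<Rightarrow> real \<Rightarrow> real \<Rightarrow> real \<Rightarrow> real" where
  "wcomb \<alpha> s t a b =
     (if \<alpha> = \<infinity> then max a b
      else (s * a powr real_of_ereal \<alpha> + t * b powr real_of_ereal \<alpha>) powr (1 / real_of_ereal \<alpha>))"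

definition int_lattice :: "(real ^ 'n) set" where
  "int_lattice = {z. \<forall>i. z $ i \<in> \<int>}"

definition open_cube :: "(real ^ 'n) set" where
  "open_cube = {u. \<forall>i. -1 < u $ i \<and> u $ i < 1}"

definition diamond :: "(real ^ 'n \<Rightarrow> real) \<Rightarrow> real ^ 'n \<Rightarrow> ennreal" where
  "diamond \<phi> z = (SUP u\<in>open_cube. ennreal (\<phi> (z + u)))"

end

theory Submission
  imports Defs
begin

text \<open>The claim is a discrete inequality of Borell-Brascamp-Lieb type. For a fixed \<open>\<mu>\<close>
strictly between 0 and 1 let
\<open>s = (1 - \<lambda>) powr (1/p) * (1 - \<mu>) powr (1/q)\<close> and \<open>t = \<lambda> powr (1/p) * \<mu> powr (1/q)\<close> be the
two weights in the hypothesis; Hoelder's inequality gives \<open>s + t \<le> 1\<close>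
(\<open>holder_weights_le_1\<close>). For \<open>\<alpha> \<noteq> 0\<close>, let \<open>A\<close> and \<open>B\<close> be the two lattice sums, assumed
positive, and \<open>\<gamma> = \<alpha> / (n * \<alpha> + 1)\<close>. The core is the bound
\<open>(s * A powr \<gamma> + t * B powr \<gamma>) powr (1/\<gamma>)\<close> for the lattice sum of \<open>diamond h\<close>. It holds for every such
\<open>\<mu>\<close>, and \<open>\<mu>\<close> can be chosen so that Hoelder's inequality becomes an equality
(\<open>holder_equality_weight\<close>); the bound then is the mean of \<open>A\<close> and \<open>B\<close> with exponent
\<open>p * \<gamma>\<close>. For \<open>\<alpha> = -1/n\<close> the bound is the minimum of \<open>A\<close> and \<open>B\<close> for all weights, and for
\<open>\<alpha> = 0\<close> the weights \<open>1 - \<lambda>\<close> and \<open>\<lambda>\<close> give the geometric mean.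

The core bound is proved by induction on the number of coordinates (\<open>sum_lattice_box_ge\<close>), one
coordinate being summed at a time. This needs a hypothesis on lattice points that
passes to fibres: \<open>H z\<close> dominates the combination of \<open>f x\<close> and \<open>g y\<close> whenever each coordinate of
\<open>z\<close> has distance less than one from that of \<open>s *\<^sub>R x + t *\<^sub>R y\<close>. For \<open>H = diamond h\<close> this is what
the supremum over the open cube provides.

On the line (\<open>sum_lattice_line_ge\<close>) the three functions become step functions on unit intervals,
and mass is transported monotonically from \<open>f\<close> to \<open>g\<close> (\<open>transport_blocks\<close>): at equal mass
fractions the combined position sweeps out disjoint intervals, on which \<open>H\<close> is bounded below.
What remains is one inequality for numbers, \<open>dim_step\<close>, that relates the combination before and
after a summation; for power means it raises the reciprocal of the exponent by one, and it
follows from the convexity of a power (\<open>dim_step_wcomb\<close>). After \<open>n\<close> summations \<open>1/\<alpha>\<close> has become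
\<open>1/\<alpha> + n = 1/\<gamma>\<close>.\<close>

section \<open>Transport of mass on the line\<close>

text \<open>The relation that drives the induction on the dimension. Read \<open>v, w\<close> as heights of two
densities on the line and \<open>a, b\<close> as lengths: the combined height \<open>\<Phi> v w\<close> on an interval
of the combined length \<open>s * a + t * b\<close> carries at least the mass \<open>\<Psi>\<close> of the masses
\<open>v * a\<close> and \<open>w * b\<close>. If \<open>\<Phi>\<close> is the combination on the fibres over a coordinate, then
\<open>\<Psi>\<close> is the one after summation over that coordinate. For \<open>\<alpha> > -1\<close> other than zero,
the means with exponents \<open>\<alpha>\<close> and \<open>\<alpha> / (\<alpha> + 1)\<close> stand in this relation.\<close>
definition dim_step :: "real \<Rightarrow> real \<Rightarrow> (real \<Rightarrow> real \<Rightarrow> real) \<Rightarrow> (real \<Rightarrow> real \<Rightarrow> real) \<Rightarrow> bool" where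
  "dim_step s t \<Phi> \<Psi> \<longleftrightarrow>
     (\<forall>v>0. \<forall>w>0. 0 \<le> \<Phi> v w \<and> (\<forall>a>0. \<forall>b>0. \<Psi> (v * a) (w * b) \<le> \<Phi> v w * (s * a + t * b)))"

text \<open>A nonnegative step function on the line is given by the list of its steps \<open>(l, r, v)\<close>, from left to
right: value \<open>v > 0\<close> on the interval from \<open>l\<close> to \<open>r\<close>, and zero off these intervals. Empty
steps \<open>l = r\<close> are permitted because cutting a step may leave nothing of it.\<close>
fun blocks_from :: "real \<Rightarrow> (real \<times> real \<times> real) list \<Rightarrow> bool" where
  "blocks_from c [] \<longleftrightarrow> True"
| "blocks_from c ((l, r, v) # bs) \<longleftrightarrow> c \<le> l \<and> l \<le> r \<and> 0 < v \<and> blocks_from r bs"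

definition blocks_mass :: "(real \<times> real \<times> real) list \<Rightarrow> real" where
  "blocks_mass bs = (\<Sum>(l, r, v) \<leftarrow> bs. (r - l) * v)"

lemma blocks_mass_nonneg: "blocks_from c bs \<Longrightarrow> 0 \<le> blocks_mass bs"
  by (induction c bs rule: blocks_from.induct) (auto simp: blocks_mass_def)

lemma blocks_mass_simps [simp]:
  "blocks_mass [] = 0"
  "blocks_mass ((l, r, v) # bs) = (r - l) * v + blocks_mass bs"
  by (simp_all add: blocks_mass_def)

definition dominates :: "real \<Rightarrow> real \<Rightarrow> (real \<Rightarrow> real \<Rightarrow> real) \<Rightarrow> (real \<Rightarrow> ennreal) \<Rightarrow>
    (real \<times> real \<times> real) list \<Rightarrow> (real \<times> real \<times> real) list \<Rightarrow> bool" where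
  "dominates s t \<Phi> H xs ys \<longleftrightarrow>
     (\<forall>(l, r, v) \<in> set xs. \<forall>(l', r', w) \<in> set ys. \<forall>x y. l < x \<and> x < r \<and> l' < y \<and> y < r' \<longrightarrow>
        ennreal (\<Phi> v w) \<le> H (s * x + t * y))"

text \<open>One interval moves onto another one at constant speed, and the combined point sweeps an interval
of the combined length, on which \<open>H\<close> is at least \<open>c\<close>. Either both intervals are degenerate or
none is: otherwise the open product would be empty and say nothing about \<open>H\<close>.\<close>
lemma nn_integral_ge_on_image_interval:
  fixes l l' d d' s t c :: real
  assumes "0 < s" "0 < t" "0 \<le> d" "0 \<le> d'" "0 \<le> c"
    and low: "\<And>x y. \<lbrakk>l < x; x < l + d; l' < y; y < l' + d'\<rbrakk> \<Longrightarrow> ennreal c \<le> H (s * x + t * y)"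
    and pos: "0 < d \<longleftrightarrow> 0 < d'"
  shows "ennreal (c * (s * d + t * d')) \<le>
           (\<integral>\<^sup>+z\<in>{s * l + t * l'<..<s * l + t * l' + (s * d + t * d')}. H z \<partial>lborel)"
proof (cases "0 < d")
  case False
  then have "d = 0" "d' = 0" using assms by auto
  then show ?thesis by simp
next
  case True
  define e where "e = s * d + t * d'"
  have e: "0 < e" unfolding e_def using True pos assms by (simp add: add_pos_pos)
  have "ennreal c \<le> H z" if z: "s * l + t * l' < z" "z < s * l + t * l' + e" for z
  proof -
    \<comment> \<open>the point of the image interval with the same relative position in both factors\<close>
    define \<theta> where "\<theta> = (z - (s * l + t * l')) / e"
    have th: "0 < \<theta>" "\<theta> < 1" using z e by (auto simp: \<theta>_def field_simps)
    have "z = s * (l + \<theta> * d) + t * (l' + \<theta> * d')"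
    proof -
      have "\<theta> * (s * d + t * d') = z - (s * l + t * l')" using e by (simp add: \<theta>_def flip: e_def)
      then show ?thesis by (simp add: algebra_simps)
    qed
    moreover have "ennreal c \<le> H (s * (l + \<theta> * d) + t * (l' + \<theta> * d'))"
      by (rule low) (use th True pos in auto)
    ultimately show ?thesis by simp
  qed
  then have "(\<integral>\<^sup>+z. ennreal c * indicator {s * l + t * l'<..<s * l + t * l' + e} z \<partial>lborel)
      \<le> (\<integral>\<^sup>+z\<in>{s * l + t * l'<..<s * l + t * l' + e}. H z \<partial>lborel)"
    by (intro nn_integral_mono) (auto simp: indicator_def)
  also have "(\<integral>\<^sup>+z. ennreal c * indicator {s * l + t * l'<..<s * l + t * l' + e} z \<partial>lborel)
      = ennreal (c * e)"
    using e \<open>0 \<le> c\<close> by (simp add: nn_integral_cmult_indicator ennreal_mult)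
  finally show ?thesis unfolding e_def .
qed

lemma nn_integral_ray_split:
  fixes H :: "real \<Rightarrow> ennreal"
  assumes [measurable]: "H \<in> borel_measurable borel" and "a \<le> b" "0 \<le> e"
  shows "(\<integral>\<^sup>+z\<in>{b<..<b + e}. H z \<partial>lborel) + (\<integral>\<^sup>+z\<in>{b + e<..}. H z \<partial>lborel)
          \<le> (\<integral>\<^sup>+z\<in>{a<..}. H z \<partial>lborel)"
proof -
  have "(\<integral>\<^sup>+z\<in>{b<..<b + e}. H z \<partial>lborel) + (\<integral>\<^sup>+z\<in>{b + e<..}. H z \<partial>lborel)
      = (\<integral>\<^sup>+z. H z * indicator {b<..<b + e} z + H z * indicator {b + e<..} z \<partial>lborel)"
    by (rule nn_integral_add[symmetric]) measurable
  also have "\<dots> \<le> (\<integral>\<^sup>+z\<in>{a<..}. H z \<partial>lborel)"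
    using assms by (intro nn_integral_mono) (auto simp: indicator_def)
  finally show ?thesis .
qed

lemma ennreal_add_le: "ennreal (a + b) \<le> ennreal a + ennreal b"
proof (cases "0 \<le> a \<and> 0 \<le> b")
  case False
  then have "a + b \<le> a \<or> a + b \<le> b" by linarith
  then show ?thesis
    by (metis add_increasing add_increasing2 ennreal_leI zero_le)
qed simp

text \<open>The transport argument. Both step functions are exhausted from left to right at the same rate,
measured in fractions of the total masses \<open>A\<close> and \<open>B\<close>. As long as the two current values are
\<open>v\<close> and \<open>w\<close>, the two positions move by \<open>\<tau> * A / v\<close> and \<open>\<tau> * B / w\<close> while the fraction
\<open>\<tau>\<close> is spent, so the combined position sweeps an interval that contributes at least
\<open>C * \<tau>\<close> to the integral of \<open>H\<close>. The combined position only moves to the right, hence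
these intervals do not overlap and the contributions add up. Each round uses up the
leading step of one of the lists and cuts the other one.\<close>
lemma transport_blocks:
  fixes A B C s t :: real and H :: "real \<Rightarrow> ennreal"
  assumes st: "0 < s" "0 < t" and AB: "0 < A" "0 < B"
    and [measurable]: "H \<in> borel_measurable borel"
    and \<Phi>: "\<And>v w. \<lbrakk>0 < v; 0 < w\<rbrakk> \<Longrightarrow> 0 \<le> \<Phi> v w \<and> C \<le> \<Phi> v w * (s * (A / v) + t * (B / w))"
    and "blocks_from c xs" "blocks_from c' ys" "dominates s t \<Phi> H xs ys"
    and "blocks_mass xs = T * A" "blocks_mass ys = T * B"
  shows "ennreal (C * T) \<le> (\<integral>\<^sup>+z\<in>{s * c + t * c'<..}. H z \<partial>lborel)"
  using assms(7-)
proof (induction "length xs + length ys" arbitrary: xs ys c c' T rule: less_induct)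
  case less
  show ?case
  proof (cases "xs = [] \<or> ys = []")
    case True
    then have "T = 0" using less.prems AB by auto
    then show ?thesis by simp
  next
    case False
    then obtain l r v xs' l' r' w ys' where xs: "xs = (l, r, v) # xs'" and ys: "ys = (l', r', w) # ys'"
      by (metis list.exhaust prod_cases3)
    have b: "c \<le> l" "l \<le> r" "0 < v" "blocks_from r xs'" "c' \<le> l'" "l' \<le> r'" "0 < w" "blocks_from r' ys'"
      using less.prems unfolding xs ys by auto
    \<comment> \<open>the common mass fraction that can be transported between the two leading blocks\<close>
    define \<tau> where "\<tau> = min ((r - l) * v / A) ((r' - l') * w / B)"
    define d where "d = \<tau> * A / v"
    define d' where "d' = \<tau> * B / w"
    have \<tau>0: "0 \<le> \<tau>" unfolding \<tau>_def using b AB by simp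
    have "\<tau> \<le> (r - l) * v / A" "\<tau> \<le> (r' - l') * w / B" unfolding \<tau>_def by auto
    then have d: "0 \<le> d" "l + d \<le> r" "0 \<le> d'" "l' + d' \<le> r'"
      using \<tau>0 AB b by (auto simp: d_def d'_def field_simps)
    have pos: "0 < d \<longleftrightarrow> 0 < d'" unfolding d_def d'_def using AB b by (simp add: zero_less_mult_iff zero_less_divide_iff)
    have dom: "ennreal (\<Phi> v w) \<le> H (s * x + t * y)"
      if "l < x" "x < l + d" "l' < y" "y < l' + d'" for x y
      using less.prems(3) d that unfolding dominates_def xs ys by auto
    have e: "0 \<le> s * d + t * d'" using d st by simp
    have int1: "ennreal (C * \<tau>) \<le> (\<integral>\<^sup>+z\<in>{s * l + t * l'<..<s * l + t * l' + (s * d + t * d')}. H z \<partial>lborel)"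
    proof -
      have "C * \<tau> \<le> \<Phi> v w * (s * (A / v) + t * (B / w)) * \<tau>"
        using \<Phi>[of v w] b \<tau>0 by (intro mult_right_mono) auto
      also have "\<dots> = \<Phi> v w * (s * d + t * d')" by (simp add: d_def d'_def field_simps)
      finally have "ennreal (C * \<tau>) \<le> ennreal (\<Phi> v w * (s * d + t * d'))" by (rule ennreal_leI)
      also have "\<dots> \<le> (\<integral>\<^sup>+z\<in>{s * l + t * l'<..<s * l + t * l' + (s * d + t * d')}. H z \<partial>lborel)"
        using \<Phi>[of v w] b by (intro nn_integral_ge_on_image_interval dom st d pos) auto
      finally show ?thesis .
    qed
    have int2: "ennreal (C * (T - \<tau>)) \<le> (\<integral>\<^sup>+z\<in>{s * (l + d) + t * (l' + d')<..}. H z \<partial>lborel)"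
    proof -
      consider (x) "l + d = r" | (y) "l' + d' = r'"
        using AB b unfolding d_def d'_def \<tau>_def by (cases "(r - l) * v / A \<le> (r' - l') * w / B") auto
      then show ?thesis
      proof cases
        case x
        show ?thesis
        proof (rule less.hyps[where xs = xs' and ys = "(l' + d', r', w) # ys'"])
          show "dominates s t \<Phi> H xs' ((l' + d', r', w) # ys')"
            using less.prems(3) d unfolding dominates_def xs ys by fastforce
          have "(r - l) * v = \<tau> * A" using x b by (auto simp: d_def field_simps)
          then show "blocks_mass xs' = (T - \<tau>) * A"
            using less.prems(4) unfolding xs by (simp add: algebra_simps)
          have "d' * w = \<tau> * B" using b by (auto simp: d'_def field_simps)
          then show "blocks_mass ((l' + d', r', w) # ys') = (T - \<tau>) * B"
            using less.prems(5) unfolding ys by (simp add: algebra_simps)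
        qed (use x b d in \<open>auto simp: xs ys\<close>)
      next
        case y
        show ?thesis
        proof (rule less.hyps[where xs = "(l + d, r, v) # xs'" and ys = ys'])
          show "dominates s t \<Phi> H ((l + d, r, v) # xs') ys'"
            using less.prems(3) d unfolding dominates_def xs ys by fastforce
          have "(r' - l') * w = \<tau> * B" using y b by (auto simp: d'_def field_simps)
          then show "blocks_mass ys' = (T - \<tau>) * B"
            using less.prems(5) unfolding ys by (simp add: algebra_simps)
          have "d * v = \<tau> * A" using b by (auto simp: d_def field_simps)
          then show "blocks_mass ((l + d, r, v) # xs') = (T - \<tau>) * A"
            using less.prems(4) unfolding xs by (simp add: algebra_simps)
        qed (use y b d in \<open>auto simp: xs ys\<close>)
      qed
    qed
    have "ennreal (C * T) \<le> ennreal (C * \<tau>) + ennreal (C * (T - \<tau>))"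
    proof -
      have "C * T = C * \<tau> + C * (T - \<tau>)" by (simp add: algebra_simps)
      then show ?thesis by (simp only: ennreal_add_le)
    qed
    also have "\<dots> \<le> (\<integral>\<^sup>+z\<in>{s * l + t * l'<..<s * l + t * l' + (s * d + t * d')}. H z \<partial>lborel)
        + (\<integral>\<^sup>+z\<in>{s * l + t * l' + (s * d + t * d')<..}. H z \<partial>lborel)"
      using int1 int2 by (intro add_mono) (auto simp: algebra_simps)
    also have "\<dots> \<le> (\<integral>\<^sup>+z\<in>{s * c + t * c'<..}. H z \<partial>lborel)"
      using b st e by (intro nn_integral_ray_split add_mono mult_left_mono) auto
    finally show ?thesis .
  qed
qed

section \<open>The lattice inequality by induction on the coordinates\<close>
definition unit_blocks :: "(int \<Rightarrow> real) \<Rightarrow> int list \<Rightarrow> (real \<times> real \<times> real) list" where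
  "unit_blocks f as = map (\<lambda>a. (of_int a, of_int a + 1, f a)) (filter (\<lambda>a. 0 < f a) as)"

lemma blocks_from_unit_blocks:
  assumes "sorted_wrt (<) as" "\<And>a. a \<in> set as \<Longrightarrow> c \<le> of_int a"
  shows "blocks_from c (unit_blocks f as)"
  using assms
proof (induction as arbitrary: c)
  case (Cons a as)
  have "blocks_from (of_int a + 1) (unit_blocks f as)"
  proof (rule Cons.IH)
    show "of_int a + 1 \<le> (of_int b :: real)" if "b \<in> set as" for b
    proof -
      have "a + 1 \<le> b" using that Cons.prems by auto
      then show ?thesis by linarith
    qed
  qed (use Cons.prems in auto)
  moreover have "blocks_from c (unit_blocks f as)"
    using Cons by simp
  ultimately show ?case using Cons.prems by (auto simp: unit_blocks_def)
qed (simp add: unit_blocks_def)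

lemma blocks_mass_unit_blocks:
  assumes "\<And>a. 0 \<le> f a"
  shows "blocks_mass (unit_blocks f [m..n]) = (\<Sum>a\<in>{m..n}. f a)"
proof -
  have "blocks_mass (unit_blocks f as) = (\<Sum>a\<leftarrow>as. f a)" for as
    by (induction as) (use assms in \<open>auto simp: unit_blocks_def not_less intro: antisym\<close>)
  then show ?thesis using sum.distinct_set_conv_list[of "[m..n]" f] by simp
qed

text \<open>The case of dimension one. The functions \<open>f, g, H\<close> are spread over the unit intervals to the
right of the integers. A combination of points of \<open>[a, a + 1)\<close> and \<open>[b, b + 1)\<close> lies in
\<open>[m, m + s + t)\<close> with \<open>m = s * a + t * b\<close>. Since \<open>s + t \<le> 1\<close>, its integer part has
distance less than one from \<open>m\<close>; this is where the open cube \<open>(-1, 1)\<close> comes from.\<close>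
lemma sum_lattice_line_ge:
  fixes f g :: "int \<Rightarrow> real" and H :: "int \<Rightarrow> ennreal" and N :: int
  assumes st: "0 < s" "0 < t" "s + t \<le> 1" and step: "dim_step s t \<Phi> \<Psi>" and N: "0 \<le> N"
    and nonneg: "\<And>a. 0 \<le> f a" "\<And>b. 0 \<le> g b"
    and pos: "0 < (\<Sum>a\<in>{-N..N}. f a)" "0 < (\<Sum>b\<in>{-N..N}. g b)"
    and low: "\<And>a b c. \<lbrakk>a \<in> {-N..N}; b \<in> {-N..N}; c \<in> {-N..N}; 0 < f a; 0 < g b;
                \<bar>of_int c - (s * of_int a + t * of_int b)\<bar> < 1\<rbrakk> \<Longrightarrow> ennreal (\<Phi> (f a) (g b)) \<le> H c"
  shows "ennreal (\<Psi> (\<Sum>a\<in>{-N..N}. f a) (\<Sum>b\<in>{-N..N}. g b)) \<le> (\<Sum>c\<in>{-N..N}. H c)"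
proof -
  define A where "A = (\<Sum>a\<in>{-N..N}. f a)"
  define B where "B = (\<Sum>b\<in>{-N..N}. g b)"
  define H' where "H' = (\<lambda>z::real. \<Sum>c\<in>{-N..N}. H c * indicator {of_int c..<of_int c + 1} z)"
  have [measurable]: "H' \<in> borel_measurable borel" unfolding H'_def by measurable
  have dom: "dominates s t \<Phi> H' (unit_blocks f [-N..N]) (unit_blocks g [-N..N])"
    unfolding dominates_def
  proof (clarsimp simp: unit_blocks_def)
    fix a b :: int and x y :: real
    assume a: "- N \<le> a" "a \<le> N" "0 < f a" and b: "- N \<le> b" "b \<le> N" "0 < g b"
      and x: "of_int a < x" "x < of_int a + 1" and y: "of_int b < y" "y < of_int b + 1"
    define c where "c = \<lfloor>s * x + t * y\<rfloor>"
    have c: "of_int c \<le> s * x + t * y" "s * x + t * y < of_int c + 1"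
      unfolding c_def by linarith+
    have sx: "s * of_int a < s * x" "s * x < s * of_int a + s" "t * of_int b < t * y" "t * y < t * of_int b + t"
      using mult_strict_left_mono[OF x(1) st(1)] mult_strict_left_mono[OF x(2) st(1)]
        mult_strict_left_mono[OF y(1) st(2)] mult_strict_left_mono[OF y(2) st(2)]
      by (simp_all add: algebra_simps)
    have near: "\<bar>of_int c - (s * of_int a + t * of_int b)\<bar> < 1"
      using c sx st by linarith
    \<comment> \<open>as the weights add up to at most one, the box is closed under the combination\<close>
    have ab: "\<bar>of_int a\<bar> \<le> (of_int N :: real)" "\<bar>of_int b\<bar> \<le> (of_int N :: real)" using a b by linarith+
    have "\<bar>s * of_int a + t * of_int b\<bar> \<le> s * \<bar>of_int a\<bar> + t * \<bar>of_int b\<bar>"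
      using st by (metis abs_mult abs_of_pos abs_triangle_ineq)
    also have "\<dots> \<le> s * of_int N + t * of_int N"
      using ab st by (intro add_mono mult_left_mono) auto
    also have "\<dots> \<le> 1 * of_int N"
      unfolding distrib_right[symmetric] using st N by (intro mult_right_mono) auto
    finally have "\<bar>of_int c\<bar> < (of_int N + 1 :: real)" using near by linarith
    then have cN: "c \<in> {-N..N}" by (simp add: abs_less_iff)
    have "H' (s * x + t * y) = (\<Sum>c'\<in>{-N..N}. if c' = c then H c else 0)"
      unfolding H'_def
    proof (intro sum.cong refl)
      fix c' :: int
      have "of_int c' \<le> s * x + t * y \<and> s * x + t * y < of_int c' + 1 \<longleftrightarrow> c' = c"
        unfolding c_def by linarith
      then show "H c' * indicator {of_int c'..<of_int c' + 1} (s * x + t * y) = (if c' = c then H c else 0)"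
        by (auto simp: indicator_def)
    qed
    also have "\<dots> = H c" using cN by simp
    finally show "ennreal (\<Phi> (f a) (g b)) \<le> H' (s * x + t * y)"
      using low[OF _ _ cN _ _ near] a b by simp
  qed
  have "ennreal (\<Psi> A B * 1) \<le> (\<integral>\<^sup>+z\<in>{s * of_int (-N) + t * of_int (-N)<..}. H' z \<partial>lborel)"
  proof (rule transport_blocks[where A = A and B = B and \<Phi> = \<Phi>])
    show "0 \<le> \<Phi> v w \<and> \<Psi> A B \<le> \<Phi> v w * (s * (A / v) + t * (B / w))" if "0 < v" "0 < w" for v w
    proof -
      have "0 < A / v" "0 < B / w" using pos that by (auto simp: A_def B_def)
      then have "\<Psi> (v * (A / v)) (w * (B / w)) \<le> \<Phi> v w * (s * (A / v) + t * (B / w))" "0 \<le> \<Phi> v w"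
        using step that unfolding dim_step_def by blast+
      then show ?thesis using that by simp
    qed
    show "blocks_from (of_int (-N)) (unit_blocks f [-N..N])" "blocks_from (of_int (-N)) (unit_blocks g [-N..N])"
      by (intro blocks_from_unit_blocks; simp)+
  qed (use st pos dom nonneg in \<open>simp_all add: A_def B_def blocks_mass_unit_blocks\<close>)
  also have "\<dots> \<le> (\<integral>\<^sup>+z. H' z \<partial>lborel)"
    by (intro nn_integral_mono) (auto simp: indicator_def)
  also have "\<dots> = (\<Sum>c\<in>{-N..N}. \<integral>\<^sup>+z. H c * indicator {of_int c..<of_int c + 1 :: real} z \<partial>lborel)"
    unfolding H'_def by (intro nn_integral_sum) measurable
  also have "\<dots> = (\<Sum>c\<in>{-N..N}. H c)"
    by (intro sum.cong refl) (simp add: nn_integral_cmult_indicator)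
  finally show ?thesis by (simp add: A_def B_def)
qed

lemma sum_PiE_insert:
  assumes "i \<notin> I"
  shows "(\<Sum>x\<in>Pi\<^sub>E (insert i I) S. F x) = (\<Sum>a\<in>S i. \<Sum>x\<in>Pi\<^sub>E I S. F (x(i := a)))"
  unfolding PiE_insert_eq sum.reindex[OF inj_combinator[OF assms]]
  by (simp add: sum.cartesian_product case_prod_unfold)

text \<open>Induction on the set of coordinates. Fix the new coordinate to \<open>a, b, c\<close> in the three functions,
with \<open>c\<close> close to \<open>s * a + t * b\<close>. The induction hypothesis compares the sums over the fibres,
which is the hypothesis of the one-dimensional inequality for these sums as functions
of \<open>a, b, c\<close>. No floor functions survive in the statement: closeness to the combination is required
in each coordinate separately, and so it is inherited by the fibres.\<close>
lemma sum_lattice_box_ge: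
  fixes f g :: "('i \<Rightarrow> int) \<Rightarrow> real" and H :: "('i \<Rightarrow> int) \<Rightarrow> ennreal" and N :: int
    and \<Phi> :: "nat \<Rightarrow> real \<Rightarrow> real \<Rightarrow> real" and I :: "'i set"
  defines "X \<equiv> \<lambda>I. Pi\<^sub>E I (\<lambda>_::'i. {-N..N})"
  assumes st: "0 < s" "0 < t" "s + t \<le> 1" and N: "0 \<le> N" and "finite I"
    and "\<And>d. d < card I \<Longrightarrow> dim_step s t (\<Phi> d) (\<Phi> (Suc d))"
    and "\<And>x. 0 \<le> f x" "\<And>y. 0 \<le> g y"
    and "0 < (\<Sum>x\<in>X I. f x)" "0 < (\<Sum>y\<in>X I. g y)"
    and "\<And>x y z. \<lbrakk>x \<in> X I; y \<in> X I; z \<in> X I; 0 < f x; 0 < g y;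
           \<And>i. i \<in> I \<Longrightarrow> \<bar>of_int (z i) - (s * of_int (x i) + t * of_int (y i))\<bar> < 1\<rbrakk>
           \<Longrightarrow> ennreal (\<Phi> 0 (f x) (g y)) \<le> H z"
  shows "ennreal (\<Phi> (card I) (\<Sum>x\<in>X I. f x) (\<Sum>y\<in>X I. g y)) \<le> (\<Sum>z\<in>X I. H z)"
  using assms(6-)
proof (induction I arbitrary: f g H rule: finite_induct)
  case empty
  then show ?case by (simp add: X_def)
next
  case (insert i I)
  have split: "(\<Sum>x\<in>X (insert i I). F x) = (\<Sum>a\<in>{-N..N}. \<Sum>x\<in>X I. F (x(i := a)))" for F :: "_ \<Rightarrow> 'b :: comm_monoid_add"
    unfolding X_def using insert.hyps by (simp add: sum_PiE_insert)
  have ins: "x(i := a) \<in> X (insert i I)" if "x \<in> X I" "a \<in> {-N..N}" for x a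
    using that unfolding X_def by (intro PiE_fun_upd) auto
  show ?case unfolding split card_insert_disjoint[OF insert.hyps]
  proof (rule sum_lattice_line_ge[OF st])
    show "dim_step s t (\<Phi> (card I)) (\<Phi> (Suc (card I)))" using insert by simp
    show "0 < (\<Sum>a\<in>{-N..N}. \<Sum>x\<in>X I. f (x(i := a)))" "0 < (\<Sum>a\<in>{-N..N}. \<Sum>x\<in>X I. g (x(i := a)))"
      using insert.prems(4,5) unfolding split .
    fix a b c assume abc: "a \<in> {-N..N}" "b \<in> {-N..N}" "c \<in> {-N..N}"
      "0 < (\<Sum>x\<in>X I. f (x(i := a)))" "0 < (\<Sum>x\<in>X I. g (x(i := b)))"
      "\<bar>of_int c - (s * of_int a + t * of_int b)\<bar> < 1"
    show "ennreal (\<Phi> (card I) (\<Sum>x\<in>X I. f (x(i := a))) (\<Sum>x\<in>X I. g (x(i := b))))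
        \<le> (\<Sum>x\<in>X I. H (x(i := c)))"
    proof (rule insert.IH)
      fix x y z assume "x \<in> X I" "y \<in> X I" "z \<in> X I" "0 < f (x(i := a))" "0 < g (y(i := b))"
        "\<And>j. j \<in> I \<Longrightarrow> \<bar>of_int (z j) - (s * of_int (x j) + t * of_int (y j))\<bar> < 1"
      moreover have "\<bar>of_int ((z(i := c)) j) - (s * of_int ((x(i := a)) j) + t * of_int ((y(i := b)) j))\<bar> < 1"
        if "j \<in> insert i I" for j
        using calculation(6)[of j] abc(6) that insert.hyps(2) by (cases "j = i") auto
      ultimately show "ennreal (\<Phi> 0 (f (x(i := a))) (g (y(i := b)))) \<le> H (z(i := c))"
        using abc by (intro insert.prems(6) ins) blast+
    qed (use insert.prems abc insert.hyps in \<open>auto simp del: fun_upd_apply\<close>)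
  qed (use insert.prems N in \<open>auto intro: sum_nonneg\<close>)
qed

section \<open>Power means and the change of exponent\<close>
lemma powr_convex_nonpos: "p \<le> 0 \<Longrightarrow> convex_on {0<..} (\<lambda>x::real. x powr p)"
proof (rule f''_ge0_imp_convex)
  assume p: "p \<le> 0"
  show "((\<lambda>x. x powr p) has_real_derivative p * x powr (p - 1)) (at x)" if "x \<in> {0<..}" for x
    using that by (auto intro!: derivative_eq_intros)
  show "((\<lambda>x. p * x powr (p - 1)) has_real_derivative p * ((p - 1) * x powr (p - 1 - 1))) (at x)"
    if "x \<in> {0<..}" for x
    using that by (auto intro!: derivative_eq_intros)
  show "0 \<le> p * ((p - 1) * x powr (p - 1 - 1))" if "x \<in> {0<..}" for x
    using p by (intro mult_nonpos_nonpos mult_nonpos_nonneg) auto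
qed auto

text \<open>Joint convexity of the perspective \<open>P * (Q / P) powr m\<close> of the convex function \<open>x powr m\<close>: Jensen's
inequality at the points \<open>Q / P\<close> and \<open>S / R\<close> with weights proportional to \<open>s * P\<close> and
\<open>t * R\<close>. It has the effect of Hoelder's inequality for \<open>m \<ge> 1\<close> and of the reverse one for
\<open>m \<le> 0\<close>.\<close>
lemma powr_perspective_convex:
  fixes m :: real
  assumes pos: "0 < s" "0 < t" "0 < P" "0 < R" "0 < Q" "0 < S" and m: "1 \<le> m \<or> m \<le> 0"
  shows "(s * Q + t * S) powr m \<le>
    (s * P + t * R) powr (m - 1) * (s * (P * (Q / P) powr m) + t * (R * (S / R) powr m))"
proof -
  define X where "X = s * P + t * R"
  have X: "0 < X" unfolding X_def using pos by (simp add: add_pos_pos)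
  define \<pi> where "\<pi> = t * R / X"
  have \<pi>: "0 \<le> \<pi>" "\<pi> \<le> 1" "1 - \<pi> = s * P / X"
    using X pos by (auto simp: \<pi>_def field_simps) (auto simp: X_def)
  have "convex_on {0<..} (\<lambda>x::real. x powr m)"
    using m powr_convex powr_convex_nonpos by blast
  then have "((1 - \<pi>) *\<^sub>R (Q / P) + \<pi> *\<^sub>R (S / R)) powr m \<le> (1 - \<pi>) * (Q / P) powr m + \<pi> * (S / R) powr m"
    using \<pi> pos by (intro convex_onD) auto
  also have "(1 - \<pi>) *\<^sub>R (Q / P) + \<pi> *\<^sub>R (S / R) = (s * Q + t * S) / X"
    unfolding \<pi>(3) using pos X by (simp add: \<pi>_def add_divide_distrib)
  also have "(1 - \<pi>) * (Q / P) powr m + \<pi> * (S / R) powr m =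
      (s * (P * (Q / P) powr m) + t * (R * (S / R) powr m)) / X"
    unfolding \<pi>(3) by (simp add: \<pi>_def add_divide_distrib)
  finally have "X powr m * ((s * Q + t * S) / X) powr m \<le>
      X powr m * ((s * (P * (Q / P) powr m) + t * (R * (S / R) powr m)) / X)"
    by (rule mult_left_mono) simp
  also have "X powr m * ((s * Q + t * S) / X) powr m = (s * Q + t * S) powr m"
    using X pos by (simp flip: powr_mult)
  also have "X powr m * ((s * (P * (Q / P) powr m) + t * (R * (S / R) powr m)) / X) =
      X powr (m - 1) * (s * (P * (Q / P) powr m) + t * (R * (S / R) powr m))"
    using X by (simp add: powr_diff)
  finally show ?thesis unfolding X_def .
qed

text \<open>The perspective inequality with \<open>m = 1 + 1 / \<alpha>\<close>, the reciprocal of the new exponent, for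
\<open>P = v powr \<alpha>\<close> and \<open>Q = (v * a) powr (1 / m)\<close>: then \<open>P * (Q / P) powr m\<close> is just \<open>a\<close>. The
condition \<open>\<alpha> > -1\<close> says exactly that \<open>m > 1\<close> or \<open>m < 0\<close>.\<close>
lemma dim_step_wcomb:
  assumes st: "0 < s" "0 < t" and \<alpha>: "\<alpha> \<noteq> 0" "-1 < \<alpha>"
  shows "dim_step s t (wcomb (ereal \<alpha>) s t) (wcomb (ereal (\<alpha> / (\<alpha> + 1))) s t)"
  unfolding dim_step_def
proof (intro allI impI conjI)
  fix v w a b :: real assume pos: "0 < v" "0 < w" "0 < a" "0 < b"
  define \<gamma> where "\<gamma> = \<alpha> / (\<alpha> + 1)"
  have m: "1 / \<gamma> - 1 = 1 / \<alpha>" "\<alpha> * (1 / \<gamma>) = 1 + \<alpha>" "\<gamma> \<noteq> 0"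
    using \<alpha> by (auto simp: \<gamma>_def field_simps)
  have "1 \<le> 1 / \<gamma> \<or> 1 / \<gamma> \<le> 0"
    using \<alpha> by (cases "0 < \<alpha>") (auto simp: \<gamma>_def divide_le_0_iff)
  then have "(s * (v * a) powr \<gamma> + t * (w * b) powr \<gamma>) powr (1 / \<gamma>) \<le>
    (s * v powr \<alpha> + t * w powr \<alpha>) powr (1 / \<gamma> - 1) *
    (s * (v powr \<alpha> * ((v * a) powr \<gamma> / v powr \<alpha>) powr (1 / \<gamma>)) +
     t * (w powr \<alpha> * ((w * b) powr \<gamma> / w powr \<alpha>) powr (1 / \<gamma>)))"
    using st pos by (intro powr_perspective_convex) auto
  moreover have "v powr \<alpha> * ((v * a) powr \<gamma> / v powr \<alpha>) powr (1 / \<gamma>) = a" if "0 < v" "0 < a" for v a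
    unfolding powr_divide powr_powr m(2)
    using that m(3) by (simp add: powr_add)
  ultimately show "wcomb (ereal (\<alpha> / (\<alpha> + 1))) s t (v * a) (w * b) \<le> wcomb (ereal \<alpha>) s t v w * (s * a + t * b)"
    using pos by (simp add: wcomb_def m flip: \<gamma>_def)
qed (simp add: wcomb_def)

lemma dim_step_wcomb_infinity:
  assumes st: "0 < s" "0 < t"
  shows "dim_step s t (wcomb \<infinity> s t) (wcomb (ereal 1) s t)"
  unfolding dim_step_def
proof (intro allI impI conjI)
  fix v w a b :: real assume pos: "0 < v" "0 < w" "0 < a" "0 < b"
  have "s * (v * a) + t * (w * b) = v * (s * a) + w * (t * b)" by simp
  also have "\<dots> \<le> max v w * (s * a) + max v w * (t * b)"
    using st pos by (intro add_mono mult_right_mono) auto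
  finally show "wcomb (ereal 1) s t (v * a) (w * b) \<le> wcomb \<infinity> s t v w * (s * a + t * b)"
    using st pos by (simp add: wcomb_def distrib_left add_pos_pos)
qed (simp add: wcomb_def)

lemma dim_step_wcomb_min:
  assumes st: "0 < s" "0 < t"
  shows "dim_step s t (wcomb (ereal (-1)) s t) min"
  unfolding dim_step_def
proof (intro allI impI conjI)
  fix v w a b :: real assume pos: "0 < v" "0 < w" "0 < a" "0 < b"
  have X: "0 < s / v + t / w" using st pos by (simp add: add_pos_pos)
  have "min (v * a) (w * b) * (s / v + t / w) \<le> (v * a) * (s / v) + (w * b) * (t / w)"
    unfolding distrib_left using st pos by (intro add_mono mult_right_mono) auto
  also have "\<dots> = s * a + t * b" using pos by simp
  finally have "min (v * a) (w * b) \<le> (s * a + t * b) / (s / v + t / w)"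
    using X by (simp add: pos_le_divide_eq)
  moreover have "wcomb (ereal (-1)) s t v w = 1 / (s / v + t / w)"
    using X pos by (simp add: wcomb_def powr_minus divide_inverse)
  ultimately show "min (v * a) (w * b) \<le> wcomb (ereal (-1)) s t v w * (s * a + t * b)"
    by simp
qed (simp add: wcomb_def)

lemma dim_step_geometric:
  assumes l: "0 < l" "l < 1"
  shows "dim_step (1 - l) l (\<lambda>v w. v powr (1 - l) * w powr l) (\<lambda>v w. v powr (1 - l) * w powr l)"
  unfolding dim_step_def
proof (intro allI impI conjI)
  fix v w a b :: real assume pos: "0 < v" "0 < w" "0 < a" "0 < b"
  have "(v * a) powr (1 - l) * (w * b) powr l = v powr (1 - l) * w powr l * (a powr (1 - l) * b powr l)"
    using pos by (simp add: powr_mult)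
  also have "\<dots> \<le> v powr (1 - l) * w powr l * ((1 - l) * a + l * b)"
    using l pos by (intro mult_left_mono Youngs_inequality_0) auto
  finally show "(v * a) powr (1 - l) * (w * b) powr l \<le> v powr (1 - l) * w powr l * ((1 - l) * a + l * b)" .
qed simp

text \<open>The combination reached from the exponent \<open>\<alpha>\<close> after summation over \<open>d\<close> coordinates. Each
coordinate increases the reciprocal of the exponent by one, so the exponent is the index of the
theorem for dimension \<open>d\<close> and \<open>p = 1\<close>. For \<open>d = 0\<close> that index has no meaning at
\<open>\<alpha> = \<infinity>\<close>, hence the separate case.\<close>
definition raised_comb :: "ereal \<Rightarrow> real \<Rightarrow> real \<Rightarrow> nat \<Rightarrow> real \<Rightarrow> real \<Rightarrow> real" where
  "raised_comb \<alpha> s t d =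
     (if d = 0 then wcomb \<alpha> s t
      else if mean_index d 1 \<alpha> = -\<infinity> then min
      else wcomb (mean_index d 1 \<alpha>) s t)"

text \<open>The bound \<open>\<alpha> \<ge> -1/n\<close> keeps the exponent above \<open>-1\<close> for fewer than \<open>n - 1\<close> coordinates
and at least \<open>-1\<close> for \<open>n - 1\<close> of them; if it equals \<open>-1\<close> there, the last coordinate leads
to the minimum.\<close>
lemma dim_step_raised_comb:
  assumes st: "0 < s" "0 < t" and \<alpha>: "\<alpha> \<noteq> 0" "ereal (- 1 / real n) \<le> \<alpha>" and d: "d < n"
  shows "dim_step s t (raised_comb \<alpha> s t d) (raised_comb \<alpha> s t (Suc d))"
proof (cases \<alpha>)
  case PInf
  show ?thesis
  proof (cases "d = 0")
    case True
    then show ?thesis using dim_step_wcomb_infinity[OF st] PInf by (simp add: raised_comb_def mean_index_def one_ereal_def)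
  next
    case False
    then have "1 / real d / (1 / real d + 1) = 1 / real (Suc d)" by (simp add: field_simps)
    moreover have "-1 < 1 / real d" using less_le_trans[of "-1" 0 "1 / real d"] by simp
    ultimately show ?thesis using dim_step_wcomb[OF st, of "1 / real d"] PInf False
      by (simp add: raised_comb_def mean_index_def)
  qed
next
  case (real a)
  have a: "a \<noteq> 0" "- 1 / real n \<le> a" using \<alpha> real by auto
  have pos: "0 < real d * a + 1"
  proof (cases "0 \<le> a")
    case False
    have "real d * (- a) < real n * (- a)" using False d by (intro mult_strict_right_mono) auto
    also have "\<dots> \<le> 1" using a d by (simp add: field_simps)
    finally show ?thesis by simp
  qed (simp add: add_nonneg_pos)
  have pos': "0 \<le> real (Suc d) * a + 1"
  proof (cases "0 \<le> a")
    case False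
    have "real (Suc d) * (- a) \<le> real n * (- a)" using False d by (intro mult_right_mono) auto
    also have "\<dots> \<le> 1" using a d by (simp add: field_simps)
    finally show ?thesis by simp
  qed (simp add: add_nonneg_pos)
  define e where "e = a / (real d * a + 1)"
  have e: "e \<noteq> 0" using a pos by (simp add: e_def)
  have "a \<noteq> - 1 / real d" if "d \<noteq> 0" using pos that by (auto simp: field_simps)
  then have 1: "raised_comb \<alpha> s t d = wcomb (ereal e) s t"
    using real by (auto simp: raised_comb_def mean_index_def e_def)
  have iff: "a = - 1 / real (Suc d) \<longleftrightarrow> real (Suc d) * a + 1 = 0"
    by (simp add: field_simps) linarith
  have e1: "e + 1 = (real (Suc d) * a + 1) / (real d * a + 1)"
    using pos by (simp add: e_def field_simps)
  show ?thesis
  proof (cases "real (Suc d) * a + 1 = 0")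
    case True
    then have "raised_comb \<alpha> s t (Suc d) = min"
      using real iff by (simp add: raised_comb_def mean_index_def)
    moreover have "e = -1" using e1 True by simp
    ultimately show ?thesis using dim_step_wcomb_min[OF st] 1 by simp
  next
    case False
    then have "0 < real (Suc d) * a + 1" using pos' by linarith
    then have "-1 < e" using e1 pos by (smt (verit) divide_pos_pos)
    moreover have "e / (e + 1) = a / (real (Suc d) * a + 1)"
      unfolding e1 using pos by (simp add: e_def)
    moreover have "raised_comb \<alpha> s t (Suc d) = wcomb (ereal (a / (real (Suc d) * a + 1))) s t"
      using real iff False by (simp add: raised_comb_def mean_index_def)
    ultimately show ?thesis using dim_step_wcomb[OF st e] 1 by simp
  qed
qed (use \<alpha> in auto)

section \<open>From integer boxes to lattice points of bounded sets\<close>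
definition int_point :: "('n \<Rightarrow> int) \<Rightarrow> real ^ 'n" where
  "int_point x = (\<chi> i. of_int (x i))"

text \<open>The extensional function space over all coordinates, so that it is literally the box of the
induction on the coordinates.\<close>
definition int_box :: "int \<Rightarrow> ('n \<Rightarrow> int) set" where
  "int_box N = Pi\<^sub>E UNIV (\<lambda>_. {-N..N})"

lemma inj_int_point: "inj int_point"
  by (rule injI) (simp add: int_point_def vec_eq_iff fun_eq_iff)

lemma finite_int_box: "finite (int_box N :: ('n::finite \<Rightarrow> int) set)"
  unfolding int_box_def by (intro finite_PiE) auto

text \<open>All sufficiently large boxes represent the lattice points of the set, so that one box can serve
several sets at once.\<close>
lemma bounded_int_lattice:
  fixes S :: "(real ^ 'n) set"
  assumes "bounded S"
  obtains N where "0 \<le> N" "\<And>N'. N \<le> N' \<Longrightarrow> S \<inter> int_lattice = int_point ` {x \<in> int_box N'. int_point x \<in> S}"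
proof -
  obtain c where c: "\<And>x. x \<in> S \<Longrightarrow> norm x \<le> c" using assms bounded_iff by blast
  show thesis
  proof (rule that[of "max 0 \<lceil>c\<rceil>"], simp, rule antisym)
    fix N' assume N': "max 0 \<lceil>c\<rceil> \<le> N'"
    show "S \<inter> int_lattice \<subseteq> int_point ` {x \<in> int_box N'. int_point x \<in> S}"
    proof
      fix x assume x: "x \<in> S \<inter> int_lattice"
      have eq: "x = int_point (\<lambda>i. \<lfloor>x $ i\<rfloor>)"
        using x by (auto simp: int_lattice_def int_point_def vec_eq_iff elim!: Ints_cases)
      have "\<lfloor>x $ i\<rfloor> \<in> {-N'..N'}" for i
      proof -
        have "\<bar>x $ i\<bar> \<le> c" using c[of x] x component_le_norm_cart[of x i] by auto
        then have "\<bar>x $ i\<bar> \<le> of_int N'" using N' by linarith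
        moreover have "x $ i = of_int \<lfloor>x $ i\<rfloor>" using eq by (metis int_point_def vec_lambda_beta)
        ultimately have "\<bar>\<lfloor>x $ i\<rfloor>\<bar> \<le> N'" by linarith
        then show ?thesis by auto
      qed
      then have "(\<lambda>i. \<lfloor>x $ i\<rfloor>) \<in> int_box N'" by (auto simp: int_box_def)
      then show "x \<in> int_point ` {x \<in> int_box N'. int_point x \<in> S}" using x eq by force
    qed
  qed (auto simp: int_lattice_def int_point_def)
qed

lemma sum_int_lattice:
  fixes F :: "real ^ 'n \<Rightarrow> 'b::comm_monoid_add"
  assumes "S \<inter> int_lattice = int_point ` {x \<in> int_box N. int_point x \<in> S}"
  shows "(\<Sum>x \<in> S \<inter> int_lattice. F x) = (\<Sum>x \<in> int_box N. if int_point x \<in> S then F (int_point x) else 0)"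
  unfolding assms
  by (subst sum.reindex) (auto intro: inj_on_subset[OF inj_int_point] simp: sum.If_cases finite_int_box Int_def)

lemma diamond_ge:
  assumes "\<And>i. \<bar>z $ i - m $ i\<bar> < 1"
  shows "ennreal (h m) \<le> diamond h z"
proof -
  have "m - z \<in> open_cube" using assms by (auto simp: open_cube_def abs_less_iff algebra_simps)
  then have "ennreal (h (z + (m - z))) \<le> diamond h z"
    unfolding diamond_def by (intro SUP_upper)
  then show ?thesis by simp
qed

lemma bounded_open_cube: "bounded (open_cube :: (real ^ 'n) set)"
proof -
  have "open_cube \<subseteq> cbox (\<chi> i. (-1 :: real)) (\<chi> i. (1 :: real))"
    by (auto simp: open_cube_def mem_box_cart less_imp_le)
  then show ?thesis using bounded_cbox bounded_subset by blast
qed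

text \<open>Replacing \<open>f\<close>, \<open>g\<close> and \<open>diamond h\<close> by zero off \<open>K\<close>, \<open>L\<close> and \<open>M + open_cube\<close> on a common box reduces the claim to
the inequality on boxes. A lattice point \<open>z\<close> that is close to \<open>m = s *\<^sub>R x + t *\<^sub>R y\<close> in every
coordinate lies in \<open>M + open_cube\<close>, and \<open>m\<close> takes part in the supremum
that defines \<open>diamond h z\<close>.\<close>
lemma lattice_sum_ge:
  fixes K L M :: "(real ^ 'n) set" and f g h :: "real ^ 'n \<Rightarrow> real"
    and \<Phi> :: "nat \<Rightarrow> real \<Rightarrow> real \<Rightarrow> real"
  assumes st: "0 < s" "0 < t" "s + t \<le> 1"
    and bounded: "bounded K" "bounded L" "bounded M"
    and step: "\<And>d. d < CARD('n) \<Longrightarrow> dim_step s t (\<Phi> d) (\<Phi> (Suc d))"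
    and nonneg: "\<And>x. 0 \<le> f x" "\<And>y. 0 \<le> g y"
    and pos: "0 < (\<Sum>x \<in> K \<inter> int_lattice. f x)" "0 < (\<Sum>y \<in> L \<inter> int_lattice. g y)"
    and M: "\<And>x y. \<lbrakk>x \<in> K; y \<in> L\<rbrakk> \<Longrightarrow> s *\<^sub>R x + t *\<^sub>R y \<in> M"
    and low: "\<And>x y. \<lbrakk>x \<in> K; y \<in> L; 0 < f x; 0 < g y\<rbrakk> \<Longrightarrow> \<Phi> 0 (f x) (g y) \<le> h (s *\<^sub>R x + t *\<^sub>R y)"
  shows "ennreal (\<Phi> CARD('n) (\<Sum>x \<in> K \<inter> int_lattice. f x) (\<Sum>y \<in> L \<inter> int_lattice. g y))
      \<le> (\<Sum>z \<in> (M + open_cube) \<inter> int_lattice. diamond h z)"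
proof -
  have bM: "bounded (M + open_cube)"
    unfolding set_plus_image using bounded(3) bounded_open_cube by (intro bounded_plus)
  obtain N1 where N1: "0 \<le> N1" "\<And>N. N1 \<le> N \<Longrightarrow> K \<inter> int_lattice = int_point ` {x \<in> int_box N. int_point x \<in> K}"
    by (rule bounded_int_lattice[OF bounded(1)]) blast
  obtain N2 where N2: "0 \<le> N2" "\<And>N. N2 \<le> N \<Longrightarrow> L \<inter> int_lattice = int_point ` {x \<in> int_box N. int_point x \<in> L}"
    by (rule bounded_int_lattice[OF bounded(2)]) blast
  obtain N3 where N3: "0 \<le> N3" "\<And>N. N3 \<le> N \<Longrightarrow>
      (M + open_cube) \<inter> int_lattice = int_point ` {x \<in> int_box N. int_point x \<in> M + open_cube}"
    by (rule bounded_int_lattice[OF bM]) blast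
  define N where "N = max N1 (max N2 N3)"
  have N: "0 \<le> N" "N1 \<le> N" "N2 \<le> N" "N3 \<le> N" unfolding N_def using N1(1) by auto
  note sums = sum_int_lattice[OF N1(2)[OF N(2)]] sum_int_lattice[OF N2(2)[OF N(3)]] sum_int_lattice[OF N3(2)[OF N(4)]]
  show ?thesis
    unfolding sums int_box_def
  proof (rule sum_lattice_box_ge[OF st N(1) finite])
    fix x y z :: "'n \<Rightarrow> int"
    assume x: "0 < (if int_point x \<in> K then f (int_point x) else 0)"
      and y: "0 < (if int_point y \<in> L then g (int_point y) else 0)"
      and z: "\<And>i. i \<in> UNIV \<Longrightarrow> \<bar>of_int (z i) - (s * of_int (x i) + t * of_int (y i))\<bar> < 1"
    have xy: "int_point x \<in> K" "0 < f (int_point x)" "int_point y \<in> L" "0 < g (int_point y)"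
      using x y by (auto split: if_splits)
    define m where "m = s *\<^sub>R int_point x + t *\<^sub>R int_point y"
    have near: "\<bar>int_point z $ i - m $ i\<bar> < 1" for i
      using z[of i] by (simp add: m_def int_point_def)
    have "int_point z - m \<in> open_cube"
      using near by (auto simp: open_cube_def abs_less_iff algebra_simps)
    then have "m + (int_point z - m) \<in> M + open_cube"
      using M xy unfolding m_def by (intro set_plus_intro) auto
    then have in_sum: "int_point z \<in> M + open_cube" by simp
    have "ennreal (\<Phi> 0 (f (int_point x)) (g (int_point y))) \<le> ennreal (h m)"
      unfolding m_def by (intro ennreal_leI low xy)
    also have "\<dots> \<le> diamond h (int_point z)" using near by (rule diamond_ge)
    finally show "ennreal (\<Phi> 0 (if int_point x \<in> K then f (int_point x) else 0)
        (if int_point y \<in> L then g (int_point y) else 0))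
      \<le> (if int_point z \<in> M + open_cube then diamond h (int_point z) else 0)"
      using xy in_sum by simp
  qed (use step nonneg pos in \<open>auto simp: sums int_box_def\<close>)
qed

section \<open>Coefficients of the sum with exponent p\<close>
lemma holder_conjugate_cases:
  assumes "1 \<le> p" "holder_conjugate p q"
  shows "q = \<infinity> \<and> p = 1 \<or> q \<noteq> \<infinity> \<and> 1 < p \<and> 1 / real_of_ereal q = 1 - 1 / p"
proof (cases q)
  case (real r)
  then have r: "1 < r" "1 / p + 1 / r = 1" using assms by (auto simp: holder_conjugate_def one_ereal_def)
  moreover have "0 < 1 / r" using r by simp
  ultimately have "1 / p < 1" by linarith
  then show ?thesis using real r assms by (simp add: field_simps)
next
  case PInf
  then show ?thesis using assms by (auto simp: holder_conjugate_def one_ereal_def)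
qed (use assms in \<open>auto simp: holder_conjugate_def\<close>)

text \<open>For \<open>\<mu> > 0\<close> the convention for \<open>q = \<infinity>\<close> agrees with \<open>\<mu> powr 0 = 1\<close>, so that \<open>p = 1\<close> needs
no separate treatment in the interior of the unit interval.\<close>
lemma hcoeff_eq_powr:
  assumes "1 \<le> p" "holder_conjugate p q" "0 < \<mu>"
  shows "hcoeff q \<mu> = \<mu> powr (1 - 1 / p)"
  using holder_conjugate_cases[OF assms(1,2)] assms(3) by (auto simp: hcoeff_def)

lemma hcoeff_bounds:
  assumes "1 \<le> p" "holder_conjugate p q" "0 \<le> \<mu>" "\<mu> \<le> 1"
  shows "0 \<le> hcoeff q \<mu>" "hcoeff q \<mu> \<le> 1"
proof -
  show "0 \<le> hcoeff q \<mu>" by (simp add: hcoeff_def)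
  have "\<mu> powr (1 - 1 / p) \<le> 1" using assms by (intro powr_le1) auto
  then show "hcoeff q \<mu> \<le> 1"
    using holder_conjugate_cases[OF assms(1,2)] by (auto simp: hcoeff_def)
qed

lemma bounded_psum:
  fixes A B :: "'a::real_normed_vector set"
  assumes "1 \<le> p" "holder_conjugate p q" "bounded A" "bounded B"
  shows "bounded (psum q A B)"
proof -
  obtain a b where a: "\<And>x. x \<in> A \<Longrightarrow> norm x \<le> a" and b: "\<And>y. y \<in> B \<Longrightarrow> norm y \<le> b"
    using assms(3,4) by (meson bounded_iff)
  have "norm (hcoeff q (1 - \<mu>) *\<^sub>R x + hcoeff q \<mu> *\<^sub>R y) \<le> a + b"
    if "x \<in> A" "y \<in> B" "0 \<le> \<mu>" "\<mu> \<le> 1" for x y \<mu>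
  proof -
    have c: "0 \<le> hcoeff q (1 - \<mu>)" "hcoeff q (1 - \<mu>) \<le> 1" "0 \<le> hcoeff q \<mu>" "hcoeff q \<mu> \<le> 1"
      using hcoeff_bounds[OF assms(1,2)] that by auto
    have "norm (hcoeff q (1 - \<mu>) *\<^sub>R x + hcoeff q \<mu> *\<^sub>R y) \<le> hcoeff q (1 - \<mu>) * norm x + hcoeff q \<mu> * norm y"
      using norm_triangle_ineq[of "hcoeff q (1 - \<mu>) *\<^sub>R x" "hcoeff q \<mu> *\<^sub>R y"] c by simp
    also have "\<dots> \<le> 1 * a + 1 * b"
      using c a[OF that(1)] b[OF that(2)] by (intro add_mono mult_mono) auto
    finally show ?thesis by simp
  qed
  then show ?thesis unfolding bounded_iff psum_def by blast
qed

lemma bounded_pscale: "bounded A \<Longrightarrow> bounded (pscale p r A)"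
  for A :: "'a::real_normed_vector set"
  unfolding pscale_def by (rule bounded_scaling)

lemma psum_pscaleI:
  assumes "x \<in> A" "y \<in> B" "0 \<le> \<mu>" "\<mu> \<le> 1"
  shows "(r powr (1 / p) * hcoeff q (1 - \<mu>)) *\<^sub>R x + (r' powr (1 / p) * hcoeff q \<mu>) *\<^sub>R y
    \<in> psum q (pscale p r A) (pscale p r' B)"
proof -
  have "(r powr (1 / p) * hcoeff q (1 - \<mu>)) *\<^sub>R x + (r' powr (1 / p) * hcoeff q \<mu>) *\<^sub>R y =
    hcoeff q (1 - \<mu>) *\<^sub>R (r powr (1 / p) *\<^sub>R x) + hcoeff q \<mu> *\<^sub>R (r' powr (1 / p) *\<^sub>R y)"
    by (simp add: mult.commute)
  then show ?thesis unfolding psum_def pscale_def using assms by blast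
qed

text \<open>Weighted arithmetic-geometric mean inequality for each summand; the arithmetic means add up
to one.\<close>
lemma holder_weights_le_1:
  fixes p :: real
  assumes "1 \<le> p" "0 < l" "l < 1" "0 < \<mu>" "\<mu> < 1"
  shows "(1 - l) powr (1 / p) * (1 - \<mu>) powr (1 - 1 / p) + l powr (1 / p) * \<mu> powr (1 - 1 / p) \<le> 1"
proof -
  have "(1 - l) powr (1 / p) * (1 - \<mu>) powr (1 - 1 / p) \<le> 1 / p * (1 - l) + (1 - 1 / p) * (1 - \<mu>)"
    "l powr (1 / p) * \<mu> powr (1 - 1 / p) \<le> 1 / p * l + (1 - 1 / p) * \<mu>"
    using assms by (intro Youngs_inequality_0; simp)+
  moreover have "1 / p * (1 - l) + (1 - 1 / p) * (1 - \<mu>) + (1 / p * l + (1 - 1 / p) * \<mu>) = 1"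
    by (simp add: algebra_simps diff_divide_distrib)
  ultimately show ?thesis by linarith
qed

text \<open>The equality case of Hoelder's inequality
\<open>X powr (1/p) * (1 - \<mu>) powr (1 - 1/p) + Y powr (1/p) * \<mu> powr (1 - 1/p) \<le> (X + Y) powr (1/p)\<close>
with \<open>X = (1 - l) * A powr (p * \<gamma>)\<close> and \<open>Y = l * B powr (p * \<gamma>)\<close>: it occurs when \<open>\<mu>\<close> is the
share of \<open>Y\<close> in \<open>X + Y\<close>.\<close>
lemma holder_equality_weight:
  fixes p \<gamma> :: real
  assumes p: "1 \<le> p" and l: "0 < l" "l < 1" and AB: "0 < A" "0 < B"
  defines "D \<equiv> (1 - l) * A powr (p * \<gamma>) + l * B powr (p * \<gamma>)"
  obtains \<mu> where "0 < \<mu>" "\<mu> < 1"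
    "(1 - l) powr (1 / p) * (1 - \<mu>) powr (1 - 1 / p) * A powr \<gamma> + l powr (1 / p) * \<mu> powr (1 - 1 / p) * B powr \<gamma>
      = D powr (1 / p)"
proof -
  define X where "X = (1 - l) * A powr (p * \<gamma>)"
  define Y where "Y = l * B powr (p * \<gamma>)"
  have pos: "0 < X" "0 < Y" "0 < D" using l AB by (auto simp: X_def Y_def D_def add_pos_pos)
  have D: "D = X + Y" by (simp add: D_def X_def Y_def)
  have share: "c powr (1 / p) * (Z / D) powr (1 - 1 / p) * E powr \<gamma> = Z / D * D powr (1 / p)"
    if "Z = c * E powr (p * \<gamma>)" "0 < c" "0 < E" for Z c E
  proof -
    have Z: "0 < Z" using that by simp
    have "Z powr (1 / p) = c powr (1 / p) * E powr \<gamma>"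
      using that p by (simp add: powr_mult powr_powr)
    then have "c powr (1 / p) * (Z / D) powr (1 - 1 / p) * E powr \<gamma> = Z powr (1 / p) * (Z / D) powr (1 - 1 / p)"
      by simp
    also have "\<dots> = Z / D * D powr (1 / p)"
      using Z pos by (simp add: powr_divide powr_diff)
    finally show ?thesis .
  qed
  show thesis
  proof (rule that[of "Y / D"])
    have "1 - Y / D = X / D" using pos D by (simp add: field_simps)
    then show "(1 - l) powr (1 / p) * (1 - Y / D) powr (1 - 1 / p) * A powr \<gamma> + l powr (1 / p) * (Y / D) powr (1 - 1 / p) * B powr \<gamma> = D powr (1 / p)"
      using share[OF X_def] share[OF Y_def] l AB pos D by (simp flip: distrib_right add_divide_distrib)
  qed (use pos D in auto)
qed

section \<open>The inequality for the means of the two lattice sums\<close>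
theorem theorem2p1:
  fixes K L :: "(real ^ 'n) set"
    and f g h :: "real ^ 'n \<Rightarrow> real"
    and lam p :: real
    and q \<alpha> :: ereal
  assumes "0 < lam" and "lam < 1"
    and "1 \<le> p" and "holder_conjugate p q"
    and "K \<noteq> {}" and "bounded K"
    and "L \<noteq> {}" and "bounded L"
    and "ereal (- 1 / real CARD('n)) \<le> \<alpha>"
    and "\<And>x. 0 \<le> f x" and "\<And>x. 0 \<le> g x" and "\<And>x. 0 \<le> h x"
    and "\<And>x y \<mu>. \<lbrakk>\<alpha> \<noteq> 0; x \<in> K; y \<in> L; f x * g y > 0; 0 \<le> \<mu>; \<mu> \<le> 1\<rbrakk> \<Longrightarrow>
      h (((1 - lam) powr (1 / p) * hcoeff q (1 - \<mu>)) *\<^sub>R x + (lam powr (1 / p) * hcoeff q \<mu>) *\<^sub>R y)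
        \<ge> wcomb \<alpha> ((1 - lam) powr (1 / p) * hcoeff q (1 - \<mu>)) (lam powr (1 / p) * hcoeff q \<mu>) (f x) (g y)"
    and "\<And>x y. \<lbrakk>\<alpha> = 0; x \<in> K; y \<in> L; f x * g y > 0\<rbrakk> \<Longrightarrow>
      h ((1 - lam) *\<^sub>R x + lam *\<^sub>R y) \<ge> f x powr (1 - lam) * g y powr lam"
  shows "(\<Sum>z \<in> (psum q (pscale p (1 - lam) K) (pscale p lam L) + open_cube) \<inter> int_lattice. diamond h z)
    \<ge> ennreal (pmean (mean_index CARD('n) p \<alpha>) lam
        (\<Sum>x \<in> K \<inter> int_lattice. f x) (\<Sum>y \<in> L \<inter> int_lattice. g y))"
proof -
  note l = assms(1,2) and p = assms(3) and q = assms(4) and \<alpha> = assms(9)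
  define n where "n = CARD('n)"
  have n: "0 < n" by (simp add: n_def)
  define M where "M = psum q (pscale p (1 - lam) K) (pscale p lam L)"
  define A where "A = (\<Sum>x \<in> K \<inter> int_lattice. f x)"
  define B where "B = (\<Sum>y \<in> L \<inter> int_lattice. g y)"
  define \<Sigma> where "\<Sigma> = (\<Sum>z \<in> (M + open_cube) \<inter> int_lattice. diamond h z)"
  have bM: "bounded M"
    unfolding M_def using assms by (intro bounded_psum[OF p q] bounded_pscale)
  have "0 \<le> A" "0 \<le> B" unfolding A_def B_def using assms by (auto intro: sum_nonneg)
  have "ennreal (pmean (mean_index n p \<alpha>) lam A B) \<le> \<Sigma>"
  proof (cases "A = 0 \<or> B = 0")
    case True
    then show ?thesis by (auto simp: pmean_def)
  next
    case False
    with \<open>0 \<le> A\<close> \<open>0 \<le> B\<close> have AB: "0 < A" "0 < B" by auto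
    define s where "s = (\<lambda>\<mu>. (1 - lam) powr (1 / p) * (1 - \<mu>) powr (1 - 1 / p))"
    define t where "t = (\<lambda>\<mu>. lam powr (1 / p) * \<mu> powr (1 - 1 / p))"
    have st_eq: "(1 - lam) powr (1 / p) * hcoeff q (1 - \<mu>) = s \<mu>" "lam powr (1 / p) * hcoeff q \<mu> = t \<mu>"
      if "0 < \<mu>" "\<mu> < 1" for \<mu>
      using that hcoeff_eq_powr[OF p q] by (simp_all add: s_def t_def)
    have st: "0 < s \<mu>" "0 < t \<mu>" "s \<mu> + t \<mu> \<le> 1" if "0 < \<mu>" "\<mu> < 1" for \<mu>
      using that l holder_weights_le_1[OF p l that] by (auto simp: s_def t_def)
    have inM: "s \<mu> *\<^sub>R x + t \<mu> *\<^sub>R y \<in> M" if "0 < \<mu>" "\<mu> < 1" "x \<in> K" "y \<in> L" for \<mu> x y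
      using psum_pscaleI[OF that(3,4), of \<mu> "1 - lam" p q lam] that unfolding st_eq[OF that(1,2)] M_def by simp
    show ?thesis
    proof (cases "\<alpha> = 0")
      case True
      \<comment> \<open>for \<open>\<mu> = lam\<close> the two Hoelder weights are the convex weights of the hypothesis\<close>
      have sl: "s lam = 1 - lam" "t lam = lam"
        using l by (simp_all add: s_def t_def flip: powr_add)
      let ?\<Phi> = "\<lambda>(_::nat) v w. v powr (1 - lam) * w powr lam"
      have "ennreal (?\<Phi> CARD('n) A B) \<le> \<Sigma>"
        unfolding A_def B_def \<Sigma>_def
        by (rule lattice_sum_ge[where s = "1 - lam" and t = lam and \<Phi> = ?\<Phi>])
          (use l assms AB bM inM[OF l] dim_step_geometric[OF l] True in \<open>auto simp: A_def B_def sl\<close>)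
      moreover have "mean_index n p \<alpha> = 0" using True n by (simp add: mean_index_def)
      ultimately show ?thesis using AB by (simp add: pmean_def)
    next
      case False
      have bound: "ennreal (raised_comb \<alpha> (s \<mu>) (t \<mu>) n A B) \<le> \<Sigma>" if \<mu>: "0 < \<mu>" "\<mu> < 1" for \<mu>
        unfolding A_def B_def \<Sigma>_def n_def
      proof (rule lattice_sum_ge[where s = "s \<mu>" and t = "t \<mu>"])
        show "raised_comb \<alpha> (s \<mu>) (t \<mu>) 0 (f x) (g y) \<le> h (s \<mu> *\<^sub>R x + t \<mu> *\<^sub>R y)"
          if "x \<in> K" "y \<in> L" "0 < f x" "0 < g y" for x y
          using assms(13)[OF False that(1,2), of \<mu>] that \<mu> by (simp add: raised_comb_def st_eq)
        show "dim_step (s \<mu>) (t \<mu>) (raised_comb \<alpha> (s \<mu>) (t \<mu>) d) (raised_comb \<alpha> (s \<mu>) (t \<mu>) (Suc d))"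
          if "d < CARD('n)" for d
          using dim_step_raised_comb[OF st(1,2)[OF \<mu>] False \<alpha> that] .
      qed (use assms st[OF \<mu>] bM inM[OF \<mu>] AB in \<open>auto simp: A_def B_def\<close>)
      show ?thesis
      proof (cases "\<alpha> = ereal (- 1 / real n)")
        case True
        then have "mean_index n p \<alpha> = -\<infinity>" "mean_index n 1 \<alpha> = -\<infinity>" by (simp_all add: mean_index_def)
        \<comment> \<open>the minimum does not depend on the weights, so any \<open>\<mu>\<close> will do\<close>
        then show ?thesis using bound[of "1/2"] n AB by (simp add: raised_comb_def pmean_def)
      next
        case ne: False
        obtain \<gamma> where \<gamma>: "\<gamma> \<noteq> 0" "mean_index n 1 \<alpha> = ereal \<gamma>" "mean_index n p \<alpha> = ereal (p * \<gamma>)"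
        proof (cases \<alpha>)
          case (real a)
          have "a \<noteq> 0" "real n * a + 1 \<noteq> 0"
            using False ne real n by (auto simp: field_simps add_eq_0_iff)
          then show thesis using that[of "a / (real n * a + 1)"] real ne by (simp add: mean_index_def)
        qed (use that[of "1 / real n"] n \<alpha> in \<open>auto simp: mean_index_def\<close>)
        define D where "D = (1 - lam) * A powr (p * \<gamma>) + lam * B powr (p * \<gamma>)"
        obtain \<mu> where \<mu>: "0 < \<mu>" "\<mu> < 1" "s \<mu> * A powr \<gamma> + t \<mu> * B powr \<gamma> = D powr (1 / p)"
          using holder_equality_weight[OF p l AB, of \<gamma>] unfolding s_def t_def D_def by blast
        have "raised_comb \<alpha> (s \<mu>) (t \<mu>) n A B = (D powr (1 / p)) powr (1 / \<gamma>)"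
          using n \<gamma> by (simp add: raised_comb_def wcomb_def \<mu>)
        also have "\<dots> = pmean (mean_index n p \<alpha>) lam A B"
          using \<gamma> AB p by (simp add: pmean_def D_def powr_powr)
        finally show ?thesis using bound[OF \<mu>(1,2)] by simp
      qed
    qed
  qed
  then show ?thesis unfolding A_def B_def \<Sigma>_def M_def n_def .
qed

end
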